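(* Let $K_n$ denote the complete graph on $n\ge 1$ vertices without loops. Then $\mathrm{st}_+(K_n)=s(n)$, where $s(1)=0$ and, for $n\ge 2$, $$s(n)=\begin{cases}3i & \text{if } 2\cdot 3^{i-1}<n\le 3^i,\\ 3i+1 & \text{if } 3^i<n\le 4\cdot 3^{i-1},\\ 3i+2 & \text{if } 4\cdot 3^{i-1}<n\le 2\cdot 3^i,\end{cases}$$ with $i$ a nonnegative integer.
   Context: $\mathcal S_n^+$ is the set of symmetric entrywise nonnegative real $n\times n$ matrices. For $A\in\mathcal S_n^+$, $\mathrm{st}_+(A)$ is the minimal $k\ge 0$ such that $A=BCB^T$ with $B$ an entrywise nonnegative real $n\times k$ matrix and $C\in\mathcal S_k^+$ (the zero matrix has $\mathrm{st}_+=0$). The pattern graph $G(A)$ of $A$ has vertex set $[n]=\{1,\dots,n\}$ and $\{i,j\}\in E(G(A))$ iff $a_{ij}>0$ (a loop $\{i\}$ is present iff $a_{ii}>0$). For a finite undirected graph $G$ (loops allowed) with $n$ vertices (identified with $[n]$), $\mathcal S^+(G)=\{A\in\mathcal S_n^+: G(A)=G\}$ and $\mathrm{st}_+(G)=\min\{\mathrm{st}_+(A): A\in\mathcal S^+(G)\}$. Thus $\mathcal S^+(K_n)$ consists of the symmetric matrices with zero diagonal and positive off-diagonal entries. *)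

theory Defs
  imports Complex_Main "Jordan_Normal_Form.Matrix"
begin

text \<open>Matrices and graphs are indexed from 0, so the vertex set \<open>[n] = {1, ..., n}\<close> is
  rendered as \<open>{0..<n}\<close>. Dimensions may be 0: for \<open>B\<close> of size \<open>n \<times> 0\<close> and the unique
  \<open>0 \<times> 0\<close> matrix \<open>C\<close>, the product \<open>B * C * B\<^sup>T\<close> is the zero matrix of size \<open>n \<times> n\<close>.\<close>

definition nonneg_mats :: "nat \<Rightarrow> nat \<Rightarrow> real mat set" where
  "nonneg_mats n k = {B \<in> carrier_mat n k. \<forall>i<n. \<forall>j<k. 0 \<le> B $$ (i, j)}"

definition sym_nonneg_mats :: "nat \<Rightarrow> real mat set" where
  "sym_nonneg_mats n = {A \<in> nonneg_mats n n. A\<^sup>T = A}"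

definition st_plus :: "real mat \<Rightarrow> nat" where
  "st_plus A = (LEAST k. \<exists>B \<in> nonneg_mats (dim_row A) k. \<exists>C \<in> sym_nonneg_mats k. A = B * C * B\<^sup>T)"

text \<open>A graph is a pair of a vertex set and an edge set. An edge is a set \<open>{i, j}\<close> of
  vertices; it is a loop, namely \<open>{i}\<close>, if \<open>i = j\<close>.\<close>

type_synonym graph = "nat set \<times> nat set set"

definition pattern_graph :: "real mat \<Rightarrow> graph" where
  "pattern_graph A =
     ({0..<dim_row A}, {{i, j} |i j. i < dim_row A \<and> j < dim_row A \<and> A $$ (i, j) > 0})"

definition graph_mats :: "graph \<Rightarrow> real mat set" where
  "graph_mats G = {A \<in> sym_nonneg_mats (card (fst G)). pattern_graph A = G}"

definition st_plus_graph :: "graph \<Rightarrow> nat" where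
  "st_plus_graph G = (LEAST k. \<exists>A \<in> graph_mats G. st_plus A = k)"

definition complete_graph :: "nat \<Rightarrow> graph" where
  "complete_graph n = ({0..<n}, {{i, j} |i j. i < n \<and> j < n \<and> i \<noteq> j})"

text \<open>Both minima range over nonempty sets (the second one for complete graphs), so they
  are attained.\<close>

lemma st_plus_attained:
  assumes "A \<in> sym_nonneg_mats n"
  shows "\<exists>B \<in> nonneg_mats n (st_plus A). \<exists>C \<in> sym_nonneg_mats (st_plus A). A = B * C * B\<^sup>T"
proof -
  have A: "A \<in> carrier_mat n n"
    using assms by (simp add: sym_nonneg_mats_def nonneg_mats_def)
  have "1\<^sub>m n \<in> nonneg_mats n n"
    by (simp add: nonneg_mats_def)
  moreover have "A = 1\<^sub>m n * A * (1\<^sub>m n)\<^sup>T"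
    using A by simp
  ultimately have "\<exists>B \<in> nonneg_mats (dim_row A) n. \<exists>C \<in> sym_nonneg_mats n. A = B * C * B\<^sup>T"
    using assms A by (metis carrier_matD(1))
  from LeastI[where P = "\<lambda>k. \<exists>B \<in> nonneg_mats (dim_row A) k. \<exists>C \<in> sym_nonneg_mats k. A = B * C * B\<^sup>T", OF this]
  show ?thesis
    unfolding st_plus_def using A by simp
qed

lemma graph_mats_complete_graph:
  "graph_mats (complete_graph n) =
     {A \<in> carrier_mat n n. A\<^sup>T = A \<and> (\<forall>i<n. A $$ (i, i) = 0) \<and>
        (\<forall>i<n. \<forall>j<n. i \<noteq> j \<longrightarrow> A $$ (i, j) > 0)}" (is "?L = ?R")
proof (rule equalityI; rule subsetI)
  fix A assume "A \<in> ?L"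
  then have "A \<in> sym_nonneg_mats n" and G: "pattern_graph A = complete_graph n"
    unfolding graph_mats_def by (simp_all add: complete_graph_def)
  then have dim: "A \<in> carrier_mat n n" and symA: "A\<^sup>T = A"
    and nn: "\<And>i j. i < n \<Longrightarrow> j < n \<Longrightarrow> 0 \<le> A $$ (i, j)"
    unfolding sym_nonneg_mats_def nonneg_mats_def by blast+
  have E: "{{i, j} |i j. i < n \<and> j < n \<and> A $$ (i, j) > 0} = {{i, j} |i j. i < n \<and> j < n \<and> i \<noteq> j}"
    using arg_cong[OF G, of snd]
    unfolding pattern_graph_def complete_graph_def carrier_matD(1)[OF dim] snd_conv .
  have sym: "A $$ (j, i) = A $$ (i, j)" if "i < n" "j < n" for i j
    using index_transpose_mat(1)[of i A j] that dim symA by simp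
  have "A $$ (i, i) = 0" if "i < n" for i
  proof (rule ccontr)
    assume "A $$ (i, i) \<noteq> 0"
    then have "A $$ (i, i) > 0"
      using nn[OF that that] by simp
    then have "{i, i} \<in> {{i, j} |i j. i < n \<and> j < n \<and> A $$ (i, j) > 0}"
      using that by blast
    then obtain k l where "{i, i} = {k, l}" "k \<noteq> l"
      unfolding E by blast
    then show False
      by (simp add: doubleton_eq_iff)
  qed
  moreover have "A $$ (i, j) > 0" if "i < n" "j < n" "i \<noteq> j" for i j
  proof -
    have "{i, j} \<in> {{i, j} |i j. i < n \<and> j < n \<and> i \<noteq> j}"
      using that by blast
    then obtain k l where "{i, j} = {k, l}" "A $$ (k, l) > 0"
      unfolding E[symmetric] by blast
    then show ?thesis
      using sym[OF that(1,2)] unfolding doubleton_eq_iff by (elim disjE conjE) simp_all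
  qed
  ultimately show "A \<in> ?R" using dim symA by blast
next
  fix A assume A: "A \<in> ?R"
  then have dim: "A \<in> carrier_mat n n" and sym: "A\<^sup>T = A"
    and diag: "\<And>i. i < n \<Longrightarrow> A $$ (i, i) = 0"
    and off: "\<And>i j. i < n \<Longrightarrow> j < n \<Longrightarrow> i \<noteq> j \<Longrightarrow> A $$ (i, j) > 0"
    by blast+
  have pos: "A $$ (i, j) > 0 \<longleftrightarrow> i \<noteq> j" if "i < n" "j < n" for i j
    using diag[OF that(1)] off[OF that] by (cases "i = j") simp_all
  have nn: "0 \<le> A $$ (i, j)" if "i < n" "j < n" for i j
    using diag[OF that(1)] off[OF that] by (cases "i = j") simp_all
  have "(x = {i, j} \<and> i < n \<and> j < n \<and> A $$ (i, j) > 0) =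
      (x = {i, j} \<and> i < n \<and> j < n \<and> i \<noteq> j)" for x i j
    using pos[of i j] by blast
  then have "{{i, j} |i j. i < n \<and> j < n \<and> A $$ (i, j) > 0} =
      {{i, j} |i j. i < n \<and> j < n \<and> i \<noteq> j}"
    by (simp only:)
  then have "pattern_graph A = complete_graph n"
    unfolding pattern_graph_def complete_graph_def carrier_matD(1)[OF dim] by (rule arg_cong)
  moreover have "card (fst (complete_graph n)) = n"
    by (simp add: complete_graph_def)
  moreover have "A \<in> sym_nonneg_mats n"
    unfolding sym_nonneg_mats_def nonneg_mats_def using dim sym nn by blast
  ultimately show "A \<in> ?L"
    unfolding graph_mats_def by simp
qed

lemma st_plus_graph_complete_attained:
  "\<exists>A \<in> graph_mats (complete_graph n). st_plus A = st_plus_graph (complete_graph n)"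
proof -
  have "mat n n (\<lambda>(i, j). if i = j then 0 else 1) \<in> graph_mats (complete_graph n)"
    unfolding graph_mats_complete_graph by (auto intro!: eq_matI)
  then have "\<exists>k. \<exists>A \<in> graph_mats (complete_graph n). st_plus A = k"
    by blast
  then show ?thesis
    unfolding st_plus_graph_def by (rule LeastI_ex)
qed

text \<open>The exponents \<open>i - 1\<close> are integers and the bounds are reals, since \<open>i = 0\<close> is
  allowed; it is needed for \<open>n = 2\<close>, where \<open>4/3 < n \<le> 2\<close>.\<close>

definition s_case :: "nat \<Rightarrow> nat \<Rightarrow> bool" where
  "s_case n m \<longleftrightarrow> (\<exists>i::nat.
     2 * 3 powi (int i - 1) < real n \<and> real n \<le> 3 ^ i \<and> m = 3 * i \<or>
     3 ^ i < real n \<and> real n \<le> 4 * 3 powi (int i - 1) \<and> m = 3 * i + 1 \<or>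
     4 * 3 powi (int i - 1) < real n \<and> real n \<le> 2 * 3 ^ i \<and> m = 3 * i + 2)"

definition s_fun :: "nat \<Rightarrow> nat" where
  "s_fun n = (if n = 1 then 0 else THE m. s_case n m)"

text \<open>The cases cover every \<open>n \<ge> 1\<close> and are mutually exclusive, so that \<open>s_fun\<close> is well
  defined for \<open>n \<ge> 2\<close>.\<close>

lemma s_case_exists:
  assumes "1 \<le> n"
  shows "\<exists>m. s_case n m"
proof -
  define i where "i = (LEAST i. n \<le> 2 * 3 ^ i)"
  have "n < (3::nat) ^ n"
    by (rule less_exp[THEN less_le_trans]) (simp add: power_mono)
  then have "n \<le> 2 * 3 ^ n" by simp
  then have up: "n \<le> 2 * 3 ^ i"
    unfolding i_def by (rule LeastI)
  have lo: "2 * 3 powi (int i - 1) < real n"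
  proof (cases i)
    case 0
    then show ?thesis using assms by (simp add: power_int_minus)
  next
    case (Suc j)
    then have "\<not> n \<le> 2 * 3 ^ j"
      unfolding i_def by (metis lessI not_less_Least)
    then have "2 * 3 ^ j < n" by simp
    then have "real (2 * 3 ^ j) < real n" by (simp only: of_nat_less_iff)
    then show ?thesis using Suc by simp
  qed
  have "real n \<le> 2 * 3 ^ i"
    using up by (metis of_nat_le_iff of_nat_mult of_nat_numeral of_nat_power)
  with lo consider "2 * 3 powi (int i - 1) < real n \<and> real n \<le> 3 ^ i"
    | "3 ^ i < real n \<and> real n \<le> 4 * 3 powi (int i - 1)"
    | "4 * 3 powi (int i - 1) < real n \<and> real n \<le> 2 * 3 ^ i"
    by linarith
  then have "s_case n (3 * i) \<or> s_case n (3 * i + 1) \<or> s_case n (3 * i + 2)"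
    by cases (simp_all only: s_case_def; blast)+
  then show ?thesis by blast
qed

lemma s_case_unique:
  assumes "s_case n m" "s_case n m'"
  shows "m = m'"
proof -
  define a where "a i = (3::real) powi (int i - 1)" for i :: nat
  have p: "3 ^ i = 3 * a i" for i :: nat
    by (simp add: a_def power_int_diff)
  have pos: "0 < a i" for i :: nat
    by (simp add: a_def)
  have mono: "i \<le> j" if "2 * a i < real n" "real n \<le> 6 * a j" for i j :: nat
  proof (rule ccontr)
    assume "\<not> i \<le> j"
    then have "(3::real) powi int j \<le> 3 powi (int i - 1)"
      by (intro power_int_increasing) auto
    then show False using that p[of j] by (simp add: a_def)
  qed
  have spec: "\<exists>i. 2 * a i < real n \<and> real n \<le> 6 * a i \<and>
      (if real n \<le> 3 * a i then m = 3 * i else if real n \<le> 4 * a i then m = 3 * i + 1 else m = 3 * i + 2)"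
    if m: "s_case n m" for m
  proof -
    obtain i where "2 * a i < real n \<and> real n \<le> 3 * a i \<and> m = 3 * i \<or>
       3 * a i < real n \<and> real n \<le> 4 * a i \<and> m = 3 * i + 1 \<or>
       4 * a i < real n \<and> real n \<le> 2 * (3 * a i) \<and> m = 3 * i + 2"
      using m unfolding s_case_def a_def[symmetric] p by blast
    then show ?thesis
      using pos[of i] by (intro exI[of _ i]) (elim disjE conjE; simp)
  qed
  obtain i where i: "2 * a i < real n" "real n \<le> 6 * a i"
      "if real n \<le> 3 * a i then m = 3 * i else if real n \<le> 4 * a i then m = 3 * i + 1 else m = 3 * i + 2"
    using spec[OF assms(1)] by blast
  obtain j where j: "2 * a j < real n" "real n \<le> 6 * a j"
      "if real n \<le> 3 * a j then m' = 3 * j else if real n \<le> 4 * a j then m' = 3 * j + 1 else m' = 3 * j + 2"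
    using spec[OF assms(2)] by blast
  have "i = j"
    using mono[OF i(1) j(2)] mono[OF j(1) i(2)] by (rule le_antisym)
  then show ?thesis
    using i(3) j(3) by (simp split: if_splits)
qed

lemma s_fun_eq_iff:
  assumes "2 \<le> n"
  shows "s_fun n = m \<longleftrightarrow> s_case n m"
proof -
  obtain m0 where m0: "s_case n m0"
    using s_case_exists[of n] assms by auto
  then have "(THE m. s_case n m) = m0"
    using s_case_unique by blast
  then show ?thesis
    using assms m0 s_case_unique by (auto simp: s_fun_def)
qed

end

theory Submission
  imports Defs
begin

text \<open>
  Write \<open>A = B * C * B\<^sup>T\<close> with nonnegative factors and inner dimension \<open>k\<close>. No cancellation can
  occur, so only the positions of the positive entries matter: \<open>C\<close> is a graph on \<open>k\<close> vertices, row
  \<open>i\<close> of \<open>B\<close> selects the set \<open>S\<^sub>i\<close> of vertices where it is positive, and \<open>A $$ (i, j)\<close> is positive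
  iff some edge of \<open>C\<close> runs from \<open>S\<^sub>i\<close> to \<open>S\<^sub>j\<close>. The pattern of \<open>A\<close> is therefore \<open>K\<^sub>n\<close> iff each
  \<open>S\<^sub>i\<close> is independent and any two of them are joined by an edge.

  Enlarge each \<open>S\<^sub>i\<close> to a maximal independent set. Two of these are still joined by an edge, hence
  they are distinct, and so the graph has at least \<open>n\<close> maximal independent sets. Conversely, two
  distinct maximal independent sets are always joined by an edge, so that any \<open>n\<close> of them yield a
  factorization. Thus \<open>st\<^sub>+(K\<^sub>n)\<close> is the least number of vertices of a graph with at least \<open>n\<close>
  maximal independent sets.

  The theorem of Moon and Moser determines the largest number of maximal independent sets on \<open>k\<close>
  vertices: it is \<open>3^i\<close>, \<open>4 * 3^(i - 1)\<close> or \<open>2 * 3^i\<close> for \<open>k = 3 * i\<close>, \<open>3 * i + 1\<close>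
  or \<open>3 * i + 2\<close> (and 1 for \<open>k = 1\<close>), see \<open>card_max_indep_sets_le\<close> for the bound and
  \<open>moon_moser_sharp\<close> for the graphs that attain it. Inverting this function of \<open>k\<close> gives the
  three cases of \<open>s\<close>.
\<close>

section \<open>The Moon--Moser numbers\<close>

fun moon_moser :: "nat \<Rightarrow> nat" where
  "moon_moser k = (if k \<le> 1 then 1 else if k \<le> 4 then k else 3 * moon_moser (k - 3))"

declare moon_moser.simps [simp del]

lemma moon_moser_small:
  "moon_moser 0 = 1" "moon_moser (Suc 0) = 1"
  "moon_moser 2 = 2" "moon_moser 3 = 3" "moon_moser 4 = 4"
  by (simp_all add: moon_moser.simps)

lemma moon_moser_add_3:
  assumes "2 \<le> k"
  shows "moon_moser (k + 3) = 3 * moon_moser k"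
  using assms moon_moser.simps[of "k + 3"]
  by (cases "k = 2") (auto simp: moon_moser.simps[of 2] moon_moser.simps[of 5])

lemma moon_moser_closed_form:
  "moon_moser (3 * i + 2) = 2 * 3 ^ i"
  "moon_moser (3 * i + 3) = 3 * 3 ^ i"
  "moon_moser (3 * i + 4) = 4 * 3 ^ i"
proof (induction i)
  case (Suc i)
  {
    case 1 then show ?case
      using Suc.IH(1) moon_moser_add_3[of "3 * i + 2"] by (simp add: algebra_simps)
  next
    case 2 then show ?case
      using Suc.IH(2) moon_moser_add_3[of "3 * i + 3"] by (simp add: algebra_simps)
  next
    case 3 then show ?case
      using Suc.IH(3) moon_moser_add_3[of "3 * i + 4"] by (simp add: algebra_simps)
  }
qed (use moon_moser_small in \<open>simp_all add: numeral_2_eq_2\<close>)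

text \<open>Joining \<open>m\<close> mutually adjacent vertices to an extremal graph as a new component multiplies
  the number of maximal independent sets by \<open>m\<close>; this is the corresponding numerical fact. Once
  \<open>m \<ge> 5\<close>, it is better to use a triangle and \<open>m - 3\<close> further vertices, because
  \<open>m \<le> 3 * (m - 3)\<close>.\<close>

lemma mult_moon_moser_le: "m * moon_moser k \<le> moon_moser (k + m)"
proof (induction m rule: less_induct)
  case (less m)
  show ?case
  proof (cases "m \<le> 4")
    case True
    consider "k < 2" | i where "k = 3 * i + 2" | i where "k = 3 * i + 3" | i where "k = 3 * i + 4"
    proof -
      have "k < 2 \<or> k = 3 * ((k - 2) div 3) + 2 \<or> k = 3 * ((k - 2) div 3) + 3
          \<or> k = 3 * ((k - 2) div 3) + 4"
        by linarith
      then show ?thesis using that by blast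
    qed
    moreover have "m = 0 \<or> m = 1 \<or> m = 2 \<or> m = 3 \<or> m = 4"
      using True by linarith
    ultimately show ?thesis
    proof cases
      case 1
      then have "k = 0 \<or> k = 1" by linarith
      with \<open>m = 0 \<or> _\<close> show ?thesis
        by (elim disjE) (simp_all add: moon_moser.simps)
    next
      case (2 i)
      with \<open>m = 0 \<or> _\<close> show ?thesis
        using moon_moser_closed_form[of i] moon_moser_closed_form[of "Suc i"]
        by (elim disjE) (simp_all add: eval_nat_numeral)
    next
      case (3 i)
      with \<open>m = 0 \<or> _\<close> show ?thesis
        using moon_moser_closed_form[of i] moon_moser_closed_form[of "Suc i"]
        by (elim disjE) (simp_all add: eval_nat_numeral)
    next
      case (4 i)
      with \<open>m = 0 \<or> _\<close> show ?thesis
        using moon_moser_closed_form[of i] moon_moser_closed_form[of "Suc i"]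
          moon_moser_closed_form[of "Suc (Suc i)"]
        by (elim disjE) (simp_all add: eval_nat_numeral)
    qed
  next
    case False
    have "m * moon_moser k \<le> 3 * ((m - 3) * moon_moser k)"
      unfolding mult.assoc[symmetric] by (rule mult_le_mono1) (use False in linarith)
    also have "\<dots> \<le> 3 * moon_moser (k + (m - 3))"
      using less.IH[of "m - 3"] False by simp
    also have "\<dots> = moon_moser (k + m)"
      using moon_moser_add_3[of "k + (m - 3)"] False by simp
    finally show ?thesis .
  qed
qed

lemma mono_moon_moser: "mono moon_moser"
  by (rule mono_iff_le_Suc[THEN iffD2]) (use mult_moon_moser_le[of 1] in simp)

text \<open>The function \<open>s\<close> inverts the Moon--Moser numbers: for \<open>n \<ge> 2\<close>, the interval that
  \<open>s_case n m\<close> prescribes for \<open>n\<close> is the one between \<open>moon_moser (m - 1)\<close> and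
  \<open>moon_moser m\<close>.\<close>

lemma s_fun_le_iff_moon_moser:
  assumes "1 \<le> n"
  shows "s_fun n \<le> k \<longleftrightarrow> n \<le> moon_moser k"
proof (cases "n = 1")
  case True
  have "moon_moser 0 \<le> moon_moser k"
    using mono_moon_moser by (rule monoD) simp
  then show ?thesis
    using True by (simp add: s_fun_def moon_moser_small)
next
  case False
  define m where "m = s_fun n"
  have "s_case n m"
    using s_fun_eq_iff[of n m] assms False by (simp add: m_def)
  then obtain i where i:
    "2 * 3 powi (int i - 1) < real n \<and> real n \<le> 3 ^ i \<and> m = 3 * i \<or>
     3 ^ i < real n \<and> real n \<le> 4 * 3 powi (int i - 1) \<and> m = 3 * i + 1 \<or>
     4 * 3 powi (int i - 1) < real n \<and> real n \<le> 2 * 3 ^ i \<and> m = 3 * i + 2"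
    unfolding s_case_def by blast
  have "0 < m \<and> moon_moser (m - 1) < n \<and> n \<le> moon_moser m"
  proof (cases i)
    case 0
    then have "n = 2 \<and> m = 2"
      using i assms False by (auto simp: power_int_minus field_simps)
    then show ?thesis by (simp add: moon_moser_small)
  next
    case (Suc j)
    have p: "3 powi (int i - 1) = real (3 ^ j)" "3 ^ i = real (3 * 3 ^ j)"
      using Suc by simp_all
    have "2 * 3 ^ j < n \<and> n \<le> 3 * 3 ^ j \<and> m = 3 * j + 3 \<or>
        3 * 3 ^ j < n \<and> n \<le> 4 * 3 ^ j \<and> m = 3 * j + 4 \<or>
        4 * 3 ^ j < n \<and> n \<le> 6 * 3 ^ j \<and> m = 3 * j + 5"
      using i Suc unfolding p by linarith
    then show ?thesis
      using moon_moser_closed_form[of j] moon_moser_closed_form(1)[of "Suc j"]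
      by (elim disjE) (simp_all add: eval_nat_numeral)
  qed
  then have m: "0 < m" "moon_moser (m - 1) < n" "n \<le> moon_moser m" by auto
  have "n \<le> moon_moser k" if "m \<le> k"
    using m(3) monoD[OF mono_moon_moser that] by linarith
  moreover have "m \<le> k" if "n \<le> moon_moser k"
  proof (rule ccontr)
    assume "\<not> m \<le> k"
    then have "moon_moser k \<le> moon_moser (m - 1)"
      by (intro monoD[OF mono_moon_moser]) simp
    with m(2) that show False by linarith
  qed
  ultimately show ?thesis
    unfolding m_def by blast
qed

section \<open>Maximal independent sets\<close>

definition indep :: "('a \<Rightarrow> 'a \<Rightarrow> bool) \<Rightarrow> 'a set \<Rightarrow> bool" where
  "indep E S \<longleftrightarrow> (\<forall>u\<in>S. \<forall>v\<in>S. \<not> E u v)"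

text \<open>Maximality is encoded as domination: each vertex outside has a neighbour inside. For
  a symmetric relation without loops this is maximality with respect to inclusion.\<close>

definition max_indep_sets :: "('a \<Rightarrow> 'a \<Rightarrow> bool) \<Rightarrow> 'a set \<Rightarrow> 'a set set" where
  "max_indep_sets E V = {S. S \<subseteq> V \<and> indep E S \<and> (\<forall>u\<in>V - S. \<exists>v\<in>S. E u v)}"

lemma finite_max_indep_sets: "finite V \<Longrightarrow> finite (max_indep_sets E V)"
  by (rule finite_subset[of _ "Pow V"]) (auto simp: max_indep_sets_def)

lemma indep_extends_to_max:
  assumes "finite V" "symp E" "\<And>u. u \<in> V \<Longrightarrow> \<not> E u u" "S \<subseteq> V" "indep E S"
  obtains M where "M \<in> max_indep_sets E V" "S \<subseteq> M"
proof -
  define \<F> where "\<F> = {T. T \<subseteq> V \<and> indep E T}"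
  have "finite \<F>" "S \<in> \<F>"
    using assms(1,4,5) by (simp_all add: \<F>_def)
  then obtain M where "M \<in> \<F>" "S \<subseteq> M" and "\<forall>T\<in>\<F>. M \<subseteq> T \<longrightarrow> M = T"
    using finite_has_maximal2 by metis
  then have M: "M \<subseteq> V" "indep E M" "S \<subseteq> M"
    and max: "\<And>T. T \<subseteq> V \<Longrightarrow> indep E T \<Longrightarrow> M \<subseteq> T \<Longrightarrow> M = T"
    by (simp_all add: \<F>_def)
  have "\<exists>v\<in>M. E u v" if u: "u \<in> V - M" for u
  proof (rule ccontr)
    assume "\<not> (\<exists>v\<in>M. E u v)"
    then have "indep E (insert u M)"
      using M(1,2) u sympD[OF assms(2)] assms(3) unfolding indep_def by blast
    then show False
      using max[of "insert u M"] u M(1) by blast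
  qed
  with M that show ?thesis
    unfolding max_indep_sets_def by blast
qed

text \<open>A vertex of one set that is missing from the other is dominated by the other.\<close>

lemma max_indep_sets_joined:
  assumes "symp E" "S \<in> max_indep_sets E V" "T \<in> max_indep_sets E V" "S \<noteq> T"
  shows "\<exists>u\<in>S. \<exists>v\<in>T. E u v"
proof -
  have "(\<exists>u\<in>S. u \<in> V - T) \<or> (\<exists>v\<in>T. v \<in> V - S)"
    using assms(2-4) unfolding max_indep_sets_def by blast
  then show ?thesis
    using assms(2,3) sympD[OF assms(1)] unfolding max_indep_sets_def by blast
qed

text \<open>A maximal independent set containing \<open>w\<close> avoids the neighbours of \<open>w\<close>, and what remains of
  it after deleting \<open>w\<close> still dominates the graph outside the closed neighbourhood of \<open>w\<close>.\<close>

lemma card_max_indep_sets_containing: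
  assumes "finite V" "symp E"
  shows "card {S \<in> max_indep_sets E V. w \<in> S}
    \<le> card (max_indep_sets E (V - insert w {u \<in> V. E w u}))"
proof (rule card_inj_on_le[where f = "\<lambda>S. S - {w}"])
  show "inj_on (\<lambda>S. S - {w}) {S \<in> max_indep_sets E V. w \<in> S}"
    by (auto intro!: inj_onI)
  show "(\<lambda>S. S - {w}) ` {S \<in> max_indep_sets E V. w \<in> S}
      \<subseteq> max_indep_sets E (V - insert w {u \<in> V. E w u})"
    using sympD[OF assms(2)] unfolding max_indep_sets_def indep_def by (auto; blast)
qed (simp add: finite_max_indep_sets assms(1))

text \<open>This is the upper bound of Moon and Moser. Take a vertex \<open>v\<close> whose closed neighbourhood has
  the least size \<open>d\<close>. Each maximal independent set meets this neighbourhood, and those containing a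
  given member \<open>w\<close> of it are controlled by the graph without the closed neighbourhood of \<open>w\<close>,
  which has at most \<open>k - d\<close> of the \<open>k\<close> vertices. So there are at most
  \<open>d * moon_moser (k - d)\<close> sets altogether.\<close>

theorem card_max_indep_sets_le:
  assumes "finite V" "symp E"
  shows "card (max_indep_sets E V) \<le> moon_moser (card V)"
  using assms(1)
proof (induction V rule: finite_psubset_induct)
  case (psubset V)
  show ?case
  proof (cases "V = {}")
    case True
    then have "max_indep_sets E V = {{}}"
      by (auto simp: max_indep_sets_def indep_def)
    with True show ?thesis by (simp add: moon_moser_small)
  next
    case False
    define N where "N w = insert w {u \<in> V. E w u}" for w
    obtain v where v: "v \<in> V" and least: "\<And>w. w \<in> V \<Longrightarrow> card (N v) \<le> card (N w)"
      using False ex_has_least_nat[of "\<lambda>v. v \<in> V" _ "\<lambda>v. card (N v)"] by blast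
    have N: "N w \<subseteq> V" "finite (N w)" "w \<in> N w" if "w \<in> V" for w
      using that psubset.hyps by (auto simp: N_def)
    have branch: "card {S \<in> max_indep_sets E V. w \<in> S} \<le> moon_moser (card V - card (N v))"
      if w: "w \<in> N v" for w
    proof -
      have wV: "w \<in> V" using w N[OF v] by blast
      have "card {S \<in> max_indep_sets E V. w \<in> S} \<le> card (max_indep_sets E (V - N w))"
        unfolding N_def using psubset.hyps assms(2) by (rule card_max_indep_sets_containing)
      also have "\<dots> \<le> moon_moser (card (V - N w))"
        using N[OF wV] wV by (intro psubset.IH) blast
      also have "\<dots> \<le> moon_moser (card V - card (N v))"
        using least[OF wV] N[OF wV]
        by (intro monoD[OF mono_moon_moser]) (simp add: card_Diff_subset)
      finally show ?thesis .
    qed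
    have "max_indep_sets E V = (\<Union>w\<in>N v. {S \<in> max_indep_sets E V. w \<in> S})"
      using v by (fastforce simp: max_indep_sets_def N_def)
    then have "card (max_indep_sets E V) \<le> (\<Sum>w\<in>N v. card {S \<in> max_indep_sets E V. w \<in> S})"
      using card_UN_le[OF N(2)[OF v]] by metis
    also have "\<dots> \<le> card (N v) * moon_moser (card V - card (N v))"
      using sum_bounded_above[of "N v", OF branch] by simp
    also have "\<dots> \<le> moon_moser (card V - card (N v) + card (N v))"
      by (rule mult_moon_moser_le)
    also have "card V - card (N v) + card (N v) = card V"
      using card_mono[OF psubset.hyps N(1)[OF v]] by simp
    finally show ?thesis .
  qed
qed

text \<open>The extremal graphs are disjoint unions of triangles, possibly together with one complete
  graph on two or four vertices (or a single vertex, for \<open>k = 1\<close>). A maximal independent set picks one vertex of each component, and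
  so each new triangle triples their number.\<close>

lemma moon_moser_sharp:
  "\<exists>E. symp E \<and> irreflp E \<and> moon_moser k \<le> card (max_indep_sets E {..<k})"
proof (induction k rule: less_induct)
  case (less k)
  show ?case
  proof (cases "k \<le> 4")
    case True
    have sub: "(if k = 0 then {{}} else (\<lambda>u. {u}) ` {..<k}) \<subseteq> max_indep_sets (\<noteq>) {..<k}"
      by (auto simp: max_indep_sets_def indep_def)
    have "moon_moser k = card (if k = 0 then {{}} else (\<lambda>u. {u}) ` {..<k})"
      using True by (simp add: moon_moser.simps[of k] card_image)
    also have "\<dots> \<le> card (max_indep_sets (\<noteq>) {..<k})"
      using sub by (rule card_mono[rotated]) (simp add: finite_max_indep_sets)
    finally show ?thesis
      by (intro exI[of _ "(\<noteq>)"]) (auto intro: sympI irreflpI)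
  next
    case False
    define l where "l = k - 3"
    have k: "k = l + 3" and l: "2 \<le> l" using False by (simp_all add: l_def)
    obtain E where E: "symp E" "irreflp E" and IH: "moon_moser l \<le> card (max_indep_sets E {..<l})"
      using less.IH[of l] k by auto
    define E' where "E' u v \<longleftrightarrow> (if u < l \<and> v < l then E u v else l \<le> u \<and> l \<le> v \<and> u \<noteq> v)" for u v
    have E': "symp E'" "irreflp E'"
      using sympD[OF E(1)] irreflpD[OF E(2)] by (auto simp: E'_def intro!: sympI irreflpI split: if_splits)
    let ?M = "max_indep_sets E {..<l} \<times> {l..<k}"
    have sub: "(\<lambda>(S, x). insert x S) ` ?M \<subseteq> max_indep_sets E' {..<k}"
    proof clarify
      fix S x assume S: "S \<in> max_indep_sets E {..<l}" and x: "x \<in> {l..<k}"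
      have "\<exists>v\<in>insert x S. E' u v" if u: "u \<in> {..<k} - insert x S" for u
      proof (cases "u < l")
        case True
        then obtain v where "v \<in> S" "E u v" "v < l"
          using S u unfolding max_indep_sets_def by blast
        then show ?thesis using True by (auto simp: E'_def)
      next
        case False
        then show ?thesis using u x by (auto simp: E'_def)
      qed
      then show "insert x S \<in> max_indep_sets E' {..<k}"
        using S x unfolding max_indep_sets_def indep_def by (auto simp: E'_def)
    qed
    have inj: "inj_on (\<lambda>(S, x). insert x S) ?M"
    proof (rule inj_onI, clarify)
      fix S x T y
      assume S: "S \<in> max_indep_sets E {..<l}" and T: "T \<in> max_indep_sets E {..<l}"
        and x: "x \<in> {l..<k}" and y: "y \<in> {l..<k}" and eq: "insert x S = insert y T"
      have "S \<subseteq> {..<l}" "T \<subseteq> {..<l}"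
        using S T by (auto simp: max_indep_sets_def)
      then have "S = insert x S \<inter> {..<l}" "T = insert y T \<inter> {..<l}"
        "{x} = insert x S - {..<l}" "{y} = insert y T - {..<l}"
        using x y by auto
      then show "S = T \<and> x = y"
        using eq by (metis singleton_inject)
    qed
    have "moon_moser k \<le> card ?M"
      using moon_moser_add_3[OF l] IH k by (simp add: card_cartesian_product)
    also have "\<dots> = card ((\<lambda>(S, x). insert x S) ` ?M)"
      using inj by (rule card_image[symmetric])
    also have "\<dots> \<le> card (max_indep_sets E' {..<k})"
      using sub by (rule card_mono[rotated]) (simp add: finite_max_indep_sets)
    finally show ?thesis using E' by blast
  qed
qed

section \<open>Factorizations and independent sets\<close>

lemma index_triple_mat_product:
  assumes "B \<in> carrier_mat n k" "C \<in> carrier_mat k k" "i < n" "j < n"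
  shows "(B * C * B\<^sup>T) $$ (i, j) = (\<Sum>p<k. \<Sum>q<k. B $$ (i, p) * C $$ (p, q) * B $$ (j, q))"
  using assms by (simp add: scalar_prod_def sum_distrib_left mult.assoc lessThan_atLeast0)

lemma index_triple_mat_product_pos_iff:
  assumes B: "B \<in> nonneg_mats n k" and C: "C \<in> nonneg_mats k k" and ij: "i < n" "j < n"
  shows "0 < (B * C * B\<^sup>T) $$ (i, j) \<longleftrightarrow>
    (\<exists>p<k. \<exists>q<k. 0 < B $$ (i, p) \<and> 0 < C $$ (p, q) \<and> 0 < B $$ (j, q))"
proof -
  have Bnn: "0 \<le> B $$ (i, p)" "0 \<le> B $$ (j, p)" if "p < k" for p
    using B ij that by (auto simp: nonneg_mats_def)
  have Cnn: "0 \<le> C $$ (p, q)" if "p < k" "q < k" for p q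
    using C that by (auto simp: nonneg_mats_def)
  let ?t = "\<lambda>p q. B $$ (i, p) * C $$ (p, q) * B $$ (j, q)"
  have nn: "0 \<le> ?t p q" if "p < k" "q < k" for p q
    using that Bnn Cnn by simp
  have "(B * C * B\<^sup>T) $$ (i, j) = (\<Sum>p<k. \<Sum>q<k. ?t p q)"
    using B C ij by (intro index_triple_mat_product) (auto simp: nonneg_mats_def)
  also have "\<dots> = (\<Sum>(p, q)\<in>{..<k} \<times> {..<k}. ?t p q)"
    by (rule sum.cartesian_product)
  finally have eq: "(B * C * B\<^sup>T) $$ (i, j) = (\<Sum>(p, q)\<in>{..<k} \<times> {..<k}. ?t p q)" .
  have "0 < (B * C * B\<^sup>T) $$ (i, j) \<longleftrightarrow> (\<exists>(p, q)\<in>{..<k} \<times> {..<k}. 0 < ?t p q)"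
  proof
    assume "0 < (B * C * B\<^sup>T) $$ (i, j)"
    then have "\<not> (\<Sum>(p, q)\<in>{..<k} \<times> {..<k}. ?t p q) \<le> 0"
      unfolding eq by linarith
    then obtain z where "z \<in> {..<k} \<times> {..<k}" "\<not> (case z of (p, q) \<Rightarrow> ?t p q) \<le> 0"
      using sum_nonpos[of "{..<k} \<times> {..<k}" "\<lambda>(p, q). ?t p q"] by blast
    then show "\<exists>(p, q)\<in>{..<k} \<times> {..<k}. 0 < ?t p q"
      by (auto simp: not_le intro!: bexI[of _ z])
  next
    assume "\<exists>(p, q)\<in>{..<k} \<times> {..<k}. 0 < ?t p q"
    then obtain p q where "p < k" "q < k" "0 < ?t p q" by auto
    then show "0 < (B * C * B\<^sup>T) $$ (i, j)"
      unfolding eq using nn by (intro sum_pos2[of _ "(p, q)"]) auto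
  qed
  also have "\<dots> \<longleftrightarrow> (\<exists>p<k. \<exists>q<k. 0 < B $$ (i, p) \<and> 0 < C $$ (p, q) \<and> 0 < B $$ (j, q))"
  proof -
    have "0 < ?t p q \<longleftrightarrow> 0 < B $$ (i, p) \<and> 0 < C $$ (p, q) \<and> 0 < B $$ (j, q)"
      if "p < k" "q < k" for p q
      using Bnn[OF that(1)] Bnn[OF that(2)] Cnn[OF that] by (auto simp: zero_less_mult_iff)
    then show ?thesis by auto
  qed
  finally show ?thesis .
qed

text \<open>Vertices with a loop, that is, with a positive diagonal entry in \<open>C\<close>, lie in no support of a
  row of \<open>B\<close>. After discarding them, the supports extend to pairwise distinct maximal independent
  sets.\<close>

lemma complete_factorization_bound:
  assumes A: "A \<in> graph_mats (complete_graph n)"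
    and B: "B \<in> nonneg_mats n k" and C: "C \<in> sym_nonneg_mats k" and eq: "A = B * C * B\<^sup>T"
  shows "n \<le> moon_moser k"
proof -
  have Cn: "C \<in> nonneg_mats k k" and Csym: "C\<^sup>T = C" and dimC: "C \<in> carrier_mat k k"
    using C by (auto simp: sym_nonneg_mats_def nonneg_mats_def)
  define E where "E p q \<longleftrightarrow> p < k \<and> q < k \<and> 0 < C $$ (p, q)" for p q
  define V where "V = {p. p < k \<and> \<not> E p p}"
  define S where "S i = {p. p < k \<and> 0 < B $$ (i, p)}" for i
  have edge: "(\<exists>p\<in>S i. \<exists>q\<in>S j. E p q) \<longleftrightarrow> i \<noteq> j" if "i < n" "j < n" for i j
  proof -
    have "(\<exists>p\<in>S i. \<exists>q\<in>S j. E p q) \<longleftrightarrow> 0 < A $$ (i, j)"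
      unfolding eq index_triple_mat_product_pos_iff[OF B Cn that] by (auto simp: S_def E_def)
    also have "\<dots> \<longleftrightarrow> i \<noteq> j"
      using A that unfolding graph_mats_complete_graph by (cases "i = j") auto
    finally show ?thesis .
  qed
  have symE: "symp E"
  proof (rule sympI)
    fix p q assume "E p q"
    then show "E q p"
      using index_transpose_mat(1)[of p C q] Csym dimC by (simp add: E_def)
  qed
  have fin: "finite V" and cardV: "card V \<le> k"
    using card_mono[of "{..<k}" V] by (auto simp: V_def)
  have "\<exists>M. M \<in> max_indep_sets E V \<and> S i \<subseteq> M" if i: "i < n" for i
  proof -
    have "indep E (S i)"
      using edge[OF i i] by (auto simp: indep_def)
    moreover have "S i \<subseteq> V"
      using edge[OF i i] by (auto simp: V_def S_def)
    ultimately show ?thesis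
      using indep_extends_to_max[OF fin symE, of "S i"] unfolding V_def by blast
  qed
  then obtain M where M: "\<And>i. i < n \<Longrightarrow> M i \<in> max_indep_sets E V \<and> S i \<subseteq> M i"
    by metis
  have "inj_on M {..<n}"
  proof (rule inj_onI, rule ccontr)
    fix i j assume ij: "i \<in> {..<n}" "j \<in> {..<n}" and same: "M i = M j" and "i \<noteq> j"
    then obtain p q where "p \<in> S i" "q \<in> S j" "E p q"
      using edge[of i j] by auto
    moreover have "indep E (M i)"
      using M ij by (auto simp: max_indep_sets_def)
    ultimately show False
      using M[of i] M[of j] ij same unfolding indep_def by blast
  qed
  then have "card {..<n} \<le> card (max_indep_sets E V)"
    by (rule card_inj_on_le) (use M fin in \<open>auto simp: finite_max_indep_sets\<close>)
  also have "\<dots> \<le> moon_moser (card V)"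
    using fin symE by (rule card_max_indep_sets_le)
  also have "\<dots> \<le> moon_moser k"
    using cardV by (rule monoD[OF mono_moon_moser])
  finally show ?thesis by simp
qed

text \<open>For the converse, the rows of \<open>B\<close> are the indicator vectors of \<open>n\<close> distinct maximal
  independent sets of an extremal graph, and \<open>C\<close> is its adjacency matrix.\<close>

lemma complete_factorization_exists:
  assumes n: "n \<le> moon_moser k"
  shows "\<exists>B \<in> nonneg_mats n k. \<exists>C \<in> sym_nonneg_mats k. B * C * B\<^sup>T \<in> graph_mats (complete_graph n)"
proof -
  obtain E where E: "symp E" "irreflp E" and card: "moon_moser k \<le> card (max_indep_sets E {..<k})"
    using moon_moser_sharp by blast
  have "card {..<n} \<le> card (max_indep_sets E {..<k})"
    using n card by simp
  then obtain S where S: "S ` {..<n} \<subseteq> max_indep_sets E {..<k}" "inj_on S {..<n}"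
    using card_le_inj[of "{..<n}" "max_indep_sets E {..<k}"] by (auto simp: finite_max_indep_sets)
  define B where "B = mat n k (\<lambda>(i, p). of_bool (p \<in> S i) :: real)"
  define C where "C = mat k k (\<lambda>(p, q). of_bool (E p q) :: real)"
  have B: "B \<in> nonneg_mats n k"
    by (simp add: B_def nonneg_mats_def)
  have Csym: "C\<^sup>T = C"
    using sympD[OF E(1)] by (auto simp: C_def intro!: eq_matI)
  have Cn: "C \<in> nonneg_mats k k"
    by (simp add: C_def nonneg_mats_def)
  have C: "C \<in> sym_nonneg_mats k"
    using Cn Csym by (simp add: sym_nonneg_mats_def)
  have dB: "B \<in> carrier_mat n k" and dC: "C \<in> carrier_mat k k"
    by (simp_all add: B_def C_def)
  let ?A = "B * C * B\<^sup>T"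
  have entries: "i < n \<Longrightarrow> p < k \<Longrightarrow> 0 < B $$ (i, p) \<longleftrightarrow> p \<in> S i"
    "p < k \<Longrightarrow> q < k \<Longrightarrow> 0 < C $$ (p, q) \<longleftrightarrow> E p q" for i p q
    by (simp_all add: B_def C_def)
  have pos: "0 < ?A $$ (i, j) \<longleftrightarrow> i \<noteq> j" if ij: "i < n" "j < n" for i j
  proof -
    have MS: "S i \<in> max_indep_sets E {..<k}" "S j \<in> max_indep_sets E {..<k}"
      using S(1) ij by auto
    have "0 < ?A $$ (i, j) \<longleftrightarrow> (\<exists>p<k. \<exists>q<k. p \<in> S i \<and> E p q \<and> q \<in> S j)"
      unfolding index_triple_mat_product_pos_iff[OF B Cn ij] using entries ij by meson
    also have "\<dots> \<longleftrightarrow> (\<exists>p\<in>S i. \<exists>q\<in>S j. E p q)"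
      using MS by (auto simp: max_indep_sets_def)
    also have "\<dots> \<longleftrightarrow> i \<noteq> j"
    proof (cases "i = j")
      case True
      then show ?thesis using MS by (auto simp: max_indep_sets_def indep_def)
    next
      case False
      then have "S i \<noteq> S j" using S(2) ij by (auto dest: inj_onD)
      then show ?thesis using max_indep_sets_joined[OF E(1) MS] False by simp
    qed
    finally show ?thesis .
  qed
  have nn: "0 \<le> ?A $$ (i, j)" if "i < n" "j < n" for i j
    unfolding index_triple_mat_product[OF dB dC that]
    using that by (auto intro!: sum_nonneg simp: B_def C_def)
  have "?A\<^sup>T = ?A"
    using transpose_mult[of "B * C" n k "B\<^sup>T" n] transpose_mult[OF dB dC]
      assoc_mult_mat[of B n k C k "B\<^sup>T" n] dB dC Csym by (metis mult_carrier_mat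
        transpose_carrier_mat transpose_transpose)
  moreover have "?A $$ (i, i) = 0" if "i < n" for i
    using pos[OF that that] nn[OF that that] by simp
  ultimately have "?A \<in> graph_mats (complete_graph n)"
    unfolding graph_mats_complete_graph using dB dC pos by auto
  with B C show ?thesis by blast
qed

theorem corollary4p3:
  fixes n :: nat
  assumes "n \<ge> 1"
  shows "st_plus_graph (complete_graph n) = s_fun n"
proof (rule antisym)
  obtain B C where B: "B \<in> nonneg_mats n (s_fun n)" and C: "C \<in> sym_nonneg_mats (s_fun n)"
    and A: "B * C * B\<^sup>T \<in> graph_mats (complete_graph n)"
    using complete_factorization_exists s_fun_le_iff_moon_moser[OF assms, of "s_fun n"] by blast
  have "st_plus_graph (complete_graph n) \<le> st_plus (B * C * B\<^sup>T)"
    unfolding st_plus_graph_def by (rule Least_le) (use A in blast)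
  also have "st_plus (B * C * B\<^sup>T) \<le> s_fun n"
    unfolding st_plus_def
  proof (rule Least_le)
    have "dim_row (B * C * B\<^sup>T) = n"
      using B by (auto simp: nonneg_mats_def)
    with B C show "\<exists>B' \<in> nonneg_mats (dim_row (B * C * B\<^sup>T)) (s_fun n).
        \<exists>C' \<in> sym_nonneg_mats (s_fun n). B * C * B\<^sup>T = B' * C' * B'\<^sup>T"
      by (intro bexI[of _ B] bexI[of _ C]) (simp_all only:)
  qed
  finally show "st_plus_graph (complete_graph n) \<le> s_fun n" .
next
  obtain A where A: "A \<in> graph_mats (complete_graph n)"
    and st: "st_plus A = st_plus_graph (complete_graph n)"
    using st_plus_graph_complete_attained by blast
  have "A \<in> sym_nonneg_mats n"
    using A by (simp add: graph_mats_def complete_graph_def)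
  then obtain B C where "B \<in> nonneg_mats n (st_plus A)" "C \<in> sym_nonneg_mats (st_plus A)"
    "A = B * C * B\<^sup>T"
    using st_plus_attained by blast
  then have "n \<le> moon_moser (st_plus A)"
    using complete_factorization_bound[OF A] by blast
  then show "s_fun n \<le> st_plus_graph (complete_graph n)"
    using s_fun_le_iff_moon_moser[OF assms] st by simp
qed

end
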